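(* Let $G$ be a finite group that is neither trivial nor of prime order, and let $k=|\pi(G)|$ be the number of distinct prime divisors of $|G|$. Then: (1) $\mathcal P(G)$ is totally disconnected if and only if $k=1$; (2) $\mathcal P(G)$ is bipartite if and only if $k\in\{1,2\}$.
   Context: For a finite group $G$ that is neither trivial nor of prime order, the coprime graph of subgroups $\mathcal P(G)$ is the simple graph whose vertices are the proper subgroups of $G$ (here "proper" means different from $G$ and from the trivial subgroup), two distinct vertices $H,K$ being adjacent if and only if $|H|$ and $|K|$ are coprime. $\pi(G)$ denotes the set of prime divisors of $|G|$. A graph is totally disconnected if its edge set is empty. *)

theory Defs
  imports
    "HOL-Algebra.Coset"
    "HOL-Computational_Algebra.Primes"
    "Graph_Theory.Pair_Digraph"
begin

definition proper_subgroups :: "('a, 'b) monoid_scheme \<Rightarrow> 'a set set" where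
  "proper_subgroups G = {H. subgroup H G \<and> H \<noteq> carrier G \<and> H \<noteq> {\<one>\<^bsub>G\<^esub>}}"

text \<open>
  As usual in the graph library, an undirected edge is represented by the two arcs in
  opposite directions. The lemma \<open>pair_graph_coprime_graph\<close> below confirms that the
  result is a finite simple graph.
\<close>
definition coprime_graph :: "('a, 'b) monoid_scheme \<Rightarrow> 'a set pair_pre_digraph" where
  "coprime_graph G =
     \<lparr> pverts = proper_subgroups G,
       parcs = {(H, K). H \<in> proper_subgroups G \<and> K \<in> proper_subgroups G \<and> H \<noteq> K \<and>
                        coprime (card H) (card K)} \<rparr>"

definition totally_disconnected :: "('v, 'e) pre_digraph \<Rightarrow> bool" where
  "totally_disconnected \<Gamma> \<longleftrightarrow> arcs \<Gamma> = {}"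

text \<open>
  The parts \<open>U\<close> and \<open>V\<close> may be empty, so that every graph without edges is bipartite,
  including the graph with a single vertex (the coprime graph of a cyclic group of
  order \<open>p\<^sup>2\<close>).
\<close>
definition bipartite :: "('v, 'e) pre_digraph \<Rightarrow> bool" where
  "bipartite \<Gamma> \<longleftrightarrow>
     (\<exists>U V. verts \<Gamma> = U \<union> V \<and> U \<inter> V = {} \<and>
        (\<forall>e \<in> arcs \<Gamma>. (tail \<Gamma> e \<in> U \<and> head \<Gamma> e \<in> V) \<or> (tail \<Gamma> e \<in> V \<and> head \<Gamma> e \<in> U)))"

lemma pair_graph_coprime_graph:
  assumes "finite (carrier G)"
  shows "pair_graph (coprime_graph G)"
proof -
  have fin: "finite (proper_subgroups G)"
    by (rule finite_subset[of _ "Pow (carrier G)"])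
      (use assms in \<open>auto simp: proper_subgroups_def dest: subgroup.subset\<close>)
  have "parcs (coprime_graph G) \<subseteq> proper_subgroups G \<times> proper_subgroups G"
    by (auto simp: coprime_graph_def)
  then have "finite (parcs (coprime_graph G))"
    by (rule finite_subset) (simp add: fin)
  then show ?thesis
    using fin
    by unfold_locales
      (auto simp: coprime_graph_def symmetric_def coprime_commute intro!: symI)
qed

end

theory Submission
  imports Defs "HOL-Algebra.Sylow"
begin

text \<open>
  A subgroup of prime order (Cauchy) is a vertex because \<open>|G|\<close> is not prime, and subgroups of
  different prime orders are adjacent, so \<open>k\<close> primes give a complete subgraph on \<open>k\<close> vertices.
  Conversely, adjacent vertices have orders with disjoint nonempty sets of prime divisors. For
  \<open>k = 1\<close> this is impossible; for \<open>k = 2\<close> exactly one of the two orders is divisible by a chosen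
  prime divisor of \<open>|G|\<close>, and this splits the vertices into two parts.
\<close>

text \<open>A vertex is nontrivial, so some prime divides its order; Lagrange puts that prime among
  those of \<open>order G\<close>. Both upper bounds on edges compare such primes at the two
  ends.\<close>

lemma (in group) proper_subgroup_prime_divisor:
  assumes "finite (carrier G)" and "H \<in> proper_subgroups G"
  obtains p where "p \<in> prime_factors (order G)" and "p dvd card H"
proof -
  have sub: "subgroup H G" and "H \<noteq> {\<one>}"
    using assms by (auto simp: proper_subgroups_def)
  have "card H \<noteq> 1"
    using subgroup.one_closed[OF sub] \<open>H \<noteq> {\<one>}\<close> by (auto simp: card_1_singleton_iff)
  then obtain p where "prime p" "p dvd card H"
    using prime_factor_nat by blast
  moreover have "card H dvd order G"
    by (metis lagrange[OF sub] dvd_triv_right)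
  moreover have "order G \<noteq> 0"
    using order_gt_0_iff_finite assms(1) by simp
  ultimately show thesis
    by (intro that[of p]) (auto simp: in_prime_factors_iff)
qed

lemma (in group) proper_subgroup_of_prime_order:
  assumes "finite (carrier G)" and "\<not> prime (order G)" and "p \<in> prime_factors (order G)"
  obtains H where "H \<in> proper_subgroups G" and "card H = p"
proof -
  have p: "prime p" "p dvd order G"
    using assms(3) by (auto simp: in_prime_factors_iff)
  \<comment> \<open>\<open>sylow_thm\<close> accepts any power of \<open>p\<close> dividing the
    order, so exponent 1 yields Cauchy's theorem.\<close>
  then obtain m where "order G = p ^ 1 * m"
    by auto
  then obtain H where H: "subgroup H G" "card H = p"
    using sylow_thm[OF p(1) is_group _ assms(1), of 1 m] by auto
  have "H \<noteq> carrier G"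
    using H(2) p(1) assms(2) by (auto simp: order_def)
  moreover have "H \<noteq> {\<one>}"
    using H(2) p(1) by auto
  ultimately show thesis
    using that[of H] H by (auto simp: proper_subgroups_def)
qed

lemma in_parcs_coprime_graph_iff:
  "(H, K) \<in> parcs (coprime_graph G) \<longleftrightarrow>
     H \<in> proper_subgroups G \<and> K \<in> proper_subgroups G \<and> H \<noteq> K \<and> coprime (card H) (card K)"
  by (simp add: coprime_graph_def)

lemma (in group) ex_prime_order_clique:
  assumes "finite (carrier G)" and "\<not> prime (order G)"
  shows "\<exists>S. \<forall>p \<in> prime_factors (order G). \<forall>q \<in> prime_factors (order G).
    p \<noteq> q \<longrightarrow> (S p, S q) \<in> parcs (coprime_graph G)"
proof -
  have "\<forall>p \<in> prime_factors (order G). \<exists>H. H \<in> proper_subgroups G \<and> card H = p"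
    using proper_subgroup_of_prime_order[OF assms] by metis
  then obtain S where
    S: "\<forall>p \<in> prime_factors (order G). S p \<in> proper_subgroups G \<and> card (S p) = p"
    by (rule bchoice[THEN exE])
  have "(S p, S q) \<in> parcs (coprime_graph G)"
    if "p \<in> prime_factors (order G)" "q \<in> prime_factors (order G)" "p \<noteq> q" for p q
  proof -
    have "coprime p q"
      using that by (intro primes_coprime) auto
    \<comment> \<open>\<open>S p\<close> and \<open>S q\<close> are distinct because their
      cardinalities \<open>p\<close> and \<open>q\<close> differ.\<close>
    then show ?thesis
      using S that unfolding in_parcs_coprime_graph_iff by metis
  qed
  then show ?thesis
    by blast
qed

text \<open>The bound is an inequality because the trivial group, with no prime factors, satisfies
  the assumptions.\<close>

lemma (in group) totally_disconnected_coprime_graph_iff: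
  assumes "finite (carrier G)" and "\<not> prime (order G)"
  shows "totally_disconnected (with_proj (coprime_graph G)) \<longleftrightarrow>
    card (prime_factors (order G)) \<le> 1"
proof
  assume "totally_disconnected (with_proj (coprime_graph G))"
  then have "parcs (coprime_graph G) = {}"
    by (simp add: totally_disconnected_def)
  then have "p = q" if "p \<in> prime_factors (order G)" "q \<in> prime_factors (order G)" for p q
    using that ex_prime_order_clique[OF assms] by blast
  then show "card (prime_factors (order G)) \<le> 1"
    by (simp add: card_le_Suc0_iff_eq)
next
  assume "card (prime_factors (order G)) \<le> 1"
  then have uniq: "p = q" if "p \<in> prime_factors (order G)" "q \<in> prime_factors (order G)" for p q
    using that by (simp add: card_le_Suc0_iff_eq)
  have "(H, K) \<notin> parcs (coprime_graph G)" for H K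
  proof
    assume "(H, K) \<in> parcs (coprime_graph G)"
    then have HK: "H \<in> proper_subgroups G" "K \<in> proper_subgroups G" "coprime (card H) (card K)"
      by (simp_all add: in_parcs_coprime_graph_iff)
    obtain p where p: "p \<in> prime_factors (order G)" "p dvd card H"
      using proper_subgroup_prime_divisor[OF assms(1) HK(1)] .
    obtain q where q: "q \<in> prime_factors (order G)" "q dvd card K"
      using proper_subgroup_prime_divisor[OF assms(1) HK(2)] .
    \<comment> \<open>By \<open>uniq\<close> the primes found at the two ends coincide, so they form
      a common divisor of coprime orders.\<close>
    show False
      using p q uniq[OF p(1) q(1)] HK(3) by (metis coprime_common_divisor in_prime_factors_imp_prime not_prime_unit)
  qed
  then show "totally_disconnected (with_proj (coprime_graph G))"
    by (auto simp: totally_disconnected_def)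
qed

lemma (in group) bipartite_coprime_graph_iff:
  assumes "finite (carrier G)" and "\<not> prime (order G)"
  shows "bipartite (with_proj (coprime_graph G)) \<longleftrightarrow> card (prime_factors (order G)) \<le> 2"
proof
  assume "bipartite (with_proj (coprime_graph G))"
  then obtain U V where UV: "U \<inter> V = {}"
    "\<And>H K. (H, K) \<in> parcs (coprime_graph G) \<Longrightarrow> (H \<in> U \<and> K \<in> V) \<or> (H \<in> V \<and> K \<in> U)"
    unfolding bipartite_def by (auto simp: Ball_def)
  obtain S where S: "\<forall>p \<in> prime_factors (order G). \<forall>q \<in> prime_factors (order G).
      p \<noteq> q \<longrightarrow> (S p, S q) \<in> parcs (coprime_graph G)"
    using ex_prime_order_clique[OF assms] by (rule exE)
  show "card (prime_factors (order G)) \<le> 2"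
  proof (rule ccontr)
    assume "\<not> card (prime_factors (order G)) \<le> 2"
    \<comment> \<open>Three primes give a triangle; two of its vertices would have to share a part,
      although they are adjacent.\<close>
    then obtain T where T: "T \<subseteq> prime_factors (order G)" "card T = 3"
      by (metis obtain_subset_with_card_n not_less_eq_eq numeral_2_eq_2 numeral_3_eq_3)
    then obtain p q r where "T = {p, q, r}" "p \<noteq> q" "q \<noteq> r" "p \<noteq> r"
      by (auto simp: card_3_iff)
    with T(1) have "(S p, S q) \<in> parcs (coprime_graph G)" "(S q, S r) \<in> parcs (coprime_graph G)"
      "(S p, S r) \<in> parcs (coprime_graph G)"
      using S by auto
    then show False
      using UV by blast
  qed
next
  assume le: "card (prime_factors (order G)) \<le> 2"
  \<comment> \<open>\<open>p\<close> is the splitting prime: at most one prime factor differs from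
    it. If there are no prime factors, any number serves as \<open>p\<close>.\<close>
  obtain p where p: "\<And>q r. \<lbrakk>q \<in> prime_factors (order G); r \<in> prime_factors (order G);
      q \<noteq> p; r \<noteq> p\<rbrakk> \<Longrightarrow> q = r" "prime_factors (order G) = {} \<or> p \<in> prime_factors (order G)"
  proof (cases "prime_factors (order G) = {}")
    case False
    then obtain p where p: "p \<in> prime_factors (order G)"
      by blast
    with le have "card (prime_factors (order G) - {p}) \<le> Suc 0"
      by simp
    then have "\<forall>q \<in> prime_factors (order G) - {p}. \<forall>r \<in> prime_factors (order G) - {p}. q = r"
      by (subst (asm) card_le_Suc0_iff_eq) simp_all
    then show thesis
      using that[of p] p by blast
  qed (use that in auto)
  let ?U = "{H \<in> proper_subgroups G. p dvd card H}"
  let ?V = "{H \<in> proper_subgroups G. \<not> p dvd card H}"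
  have "(H \<in> ?U \<and> K \<in> ?V) \<or> (H \<in> ?V \<and> K \<in> ?U)" if "(H, K) \<in> parcs (coprime_graph G)" for H K
  proof -
    have HK: "H \<in> proper_subgroups G" "K \<in> proper_subgroups G" "coprime (card H) (card K)"
      using that by (simp_all add: in_parcs_coprime_graph_iff)
    have no_common: "\<not> s dvd card K" if "s \<in> prime_factors (order G)" "s dvd card H" for s
      using that HK(3)
      by (metis coprime_common_divisor in_prime_factors_imp_prime not_prime_unit)
    obtain q where q: "q \<in> prime_factors (order G)" "q dvd card H"
      using proper_subgroup_prime_divisor[OF assms(1) HK(1)] .
    obtain r where r: "r \<in> prime_factors (order G)" "r dvd card K"
      using proper_subgroup_prime_divisor[OF assms(1) HK(2)] .
    have "q \<noteq> r"
      using no_common q r by blast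
    \<comment> \<open>Two distinct prime factors cannot both differ from \<open>p\<close>, so
      \<open>q\<close> or \<open>r\<close> equals \<open>p\<close>.\<close>
    then have "p dvd card H \<or> p dvd card K"
      using p(1)[OF q(1) r(1)] q(2) r(2) by blast
    \<comment> \<open>The existence of \<open>q\<close> excludes the empty case, so \<open>p\<close>
      is a prime factor and \<open>no_common\<close> applies to it.\<close>
    moreover have "\<not> (p dvd card H \<and> p dvd card K)"
      using no_common p(2) q(1) by blast
    ultimately show ?thesis
      using HK by blast
  qed
  then show "bipartite (with_proj (coprime_graph G))"
    unfolding bipartite_def
    by (intro exI[of _ ?U] exI[of _ ?V]) (auto simp: coprime_graph_def)
qed

theorem corollary2p1:
  fixes G :: "('a, 'b) monoid_scheme" and k :: nat
  assumes "group G"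
    and "finite (carrier G)"
    and "carrier G \<noteq> {\<one>\<^bsub>G\<^esub>}"
    and "\<not> prime (order G)"
    and "k = card (prime_factors (order G))"
  shows "(totally_disconnected (with_proj (coprime_graph G)) \<longleftrightarrow> k = 1) \<and>
         (bipartite (with_proj (coprime_graph G)) \<longleftrightarrow> k \<in> {1, 2})"
proof -
  interpret group G
    by fact
  have "order G \<noteq> 1"
    using assms(3) order_one_triv_iff by simp
  \<comment> \<open>Zero must be excluded as well as 1, since \<open>prime_factors 0\<close> is
    empty by convention.\<close>
  moreover have "order G \<noteq> 0"
    using order_gt_0_iff_finite assms(2) by simp
  ultimately have "prime_factors (order G) \<noteq> {}"
    by (simp add: prime_factorization_empty_iff)
  \<comment> \<open>This lower bound turns \<le> 1 and \<le> 2 into \<open>k = 1\<close> and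
    membership in \<open>{1, 2}\<close>.\<close>
  then have "k \<ge> 1"
    using assms(5) by (simp add: Suc_le_eq card_gt_0_iff)
  then show ?thesis
    using totally_disconnected_coprime_graph_iff[OF assms(2,4)]
      bipartite_coprime_graph_iff[OF assms(2,4)] assms(5) by auto
qed

end
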